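(* Let $M$ be a Puiseux monoid. If $0$ is not a limit point of $M$, then $M$ is atomic.
   Context: A Puiseux monoid is an additive submonoid of $\mathbb{Q}_{\ge 0}$. Limit points are taken with respect to the usual topology of $\mathbb{R}$. An atom of $M$ is a nonzero $a\in M$ such that $a=x+y$ with $x,y\in M$ implies $x=0$ or $y=0$; $M$ is atomic if every nonzero element of $M$ is a finite sum of atoms. *)

theory Defs
  imports "HOL-Analysis.Analysis" "HOL-Library.Multiset"
begin

definition puiseux_monoid :: "rat set \<Rightarrow> bool" where
  "puiseux_monoid M \<longleftrightarrow>
     M \<subseteq> {0..} \<and> 0 \<in> M \<and> (\<forall>x\<in>M. \<forall>y\<in>M. x + y \<in> M)"

definition atoms :: "rat set \<Rightarrow> rat set" where
  "atoms M = {a \<in> M. a \<noteq> 0 \<and> (\<forall>x\<in>M. \<forall>y\<in>M. a = x + y \<longrightarrow> x = 0 \<or> y = 0)}"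

definition atomic :: "rat set \<Rightarrow> bool" where
  "atomic M \<longleftrightarrow>
     (\<forall>x\<in>M. x \<noteq> 0 \<longrightarrow> (\<exists>A. set_mset A \<subseteq> atoms M \<and> x = sum_mset A))"

end

theory Submission
  imports Defs
begin

text \<open>
  Since \<open>0\<close> is isolated in \<open>M\<close>, the nonzero elements of \<open>M\<close> are bounded below by some
  \<open>e > 0\<close>. Whenever \<open>x \<in> M\<close> splits as \<open>x = y + z\<close> with \<open>y, z \<in> M\<close> nonzero, each summand is
  therefore at most \<open>x - e\<close>. Splitting can only be repeated finitely often along any branch, so
  it ends in a decomposition into atoms; formally, this is an induction on an integer
  \<open>n\<close> with \<open>x < n * e\<close>.
\<close>

lemma puiseux_monoid_pos_lower_bound:
  assumes "puiseux_monoid M" and "\<not> (0::real) islimpt (real_of_rat ` M)"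
  shows "\<exists>e::real. e > 0 \<and> (\<forall>x\<in>M. x \<noteq> 0 \<longrightarrow> e \<le> real_of_rat x)"
proof -
  obtain e :: real where "e > 0"
    and far: "\<forall>r \<in> real_of_rat ` M. r \<noteq> 0 \<longrightarrow> \<not> dist r 0 < e"
    using assms(2) unfolding islimpt_approachable by blast
  moreover have "e \<le> real_of_rat x" if "x \<in> M" "x \<noteq> 0" for x
  proof -
    have "x \<ge> 0"
      using assms(1) that(1) by (auto simp: puiseux_monoid_def)
    then show ?thesis
      using far that by (auto simp: dist_real_def)
  qed
  ultimately show ?thesis
    by blast
qed

text \<open>
  The bound \<open>x < n * e\<close> plays the role of a length: a nonzero element costs at least \<open>e\<close>, so both
  parts of a nontrivial splitting satisfy the bound for \<open>n - 1\<close>.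
\<close>

lemma sum_of_atoms_of_lower_bound:
  fixes e :: real
  assumes "e > 0" and bound: "\<And>x. x \<in> M \<Longrightarrow> x \<noteq> 0 \<Longrightarrow> e \<le> real_of_rat x"
    and "x \<in> M" "x \<noteq> 0" "real_of_rat x < real n * e"
  shows "\<exists>A. set_mset A \<subseteq> atoms M \<and> x = sum_mset A"
  using assms(3-)
proof (induction n arbitrary: x)
  case 0
  then have False
    using bound[OF 0(1,2)] \<open>e > 0\<close> by (simp del: of_rat_less_0_iff)
  then show ?case ..
next
  case (Suc n)
  show ?case
  proof (cases "x \<in> atoms M")
    case True
    then show ?thesis
      by (intro exI[of _ "{#x#}"]) simp
  next
    case False
    with Suc.prems obtain y z where yz: "y \<in> M" "z \<in> M" "x = y + z" "y \<noteq> 0" "z \<noteq> 0"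
      by (auto simp: atoms_def)
    have "real_of_rat y < real n * e" "real_of_rat z < real n * e"
      using Suc.prems(3) bound[OF yz(1,4)] bound[OF yz(2,5)]
      by (simp_all add: yz(3) of_rat_add distrib_right)
    then obtain A B where "set_mset A \<subseteq> atoms M \<and> y = sum_mset A"
      "set_mset B \<subseteq> atoms M \<and> z = sum_mset B"
      using Suc.IH[OF yz(1,4)] Suc.IH[OF yz(2,5)] by iprover
    then have "set_mset (A + B) \<subseteq> atoms M \<and> x = sum_mset (A + B)"
      using yz(3) by simp
    then show ?thesis ..
  qed
qed

theorem theorem3p10:
  fixes M :: "rat set"
  assumes "puiseux_monoid M"
    and "\<not> (0::real) islimpt (real_of_rat ` M)"
  shows "atomic M"
  unfolding atomic_def
proof (intro ballI impI)
  fix x assume x: "x \<in> M" "x \<noteq> 0"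
  obtain e :: real where e: "e > 0" "\<And>x. x \<in> M \<Longrightarrow> x \<noteq> 0 \<Longrightarrow> e \<le> real_of_rat x"
    using puiseux_monoid_pos_lower_bound[OF assms] by auto
  obtain n where "real_of_rat x < real n * e"
    using reals_Archimedean3[OF e(1)] by blast
  then show "\<exists>A. set_mset A \<subseteq> atoms M \<and> x = sum_mset A"
    using sum_of_atoms_of_lower_bound[OF e x] by simp
qed

end
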